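(* Let $\mathbb{F}$ be an algebraically closed field of characteristic $p>0$. There is no non-zero finite-dimensional perfect restricted dually atomistic Lie algebra over $\mathbb{F}$.
   Context: All algebras are finite-dimensional. A Lie algebra is called restricted dually atomistic if it is a restricted Lie algebra and every subalgebra of it (not necessarily restricted) is an intersection of maximal subalgebras (not necessarily restricted); the whole algebra is regarded as the empty intersection. A Lie algebra $L$ is perfect if $[L,L]=L$. *)

theory Defs
  imports "HOL-Computational_Algebra.Computational_Algebra"
begin

locale lie_algebra = vector_space scale
  for scale :: "'a::field \<Rightarrow> 'b::ab_group_add \<Rightarrow> 'b" (infixr \<open>*s\<close> 75) +
  fixes bracket :: "'b \<Rightarrow> 'b \<Rightarrow> 'b"
  assumes linear_bracket_right: "Vector_Spaces.linear scale scale (\<lambda>y. bracket x y)"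
    and linear_bracket_left: "Vector_Spaces.linear scale scale (\<lambda>x. bracket x y)"
    and bracket_self: "bracket x x = 0"
    and jacobi: "bracket x (bracket y z) + bracket y (bracket z x) + bracket z (bracket x y) = 0"
begin

definition subalgebra :: "'b set \<Rightarrow> bool" where
  "subalgebra S \<longleftrightarrow> subspace S \<and> (\<forall>x\<in>S. \<forall>y\<in>S. bracket x y \<in> S)"

definition maximal_subalgebra :: "'b set \<Rightarrow> bool" where
  "maximal_subalgebra M \<longleftrightarrow> subalgebra M \<and> M \<noteq> UNIV \<and>
     (\<forall>N. subalgebra N \<and> M \<subseteq> N \<longrightarrow> N = M \<or> N = UNIV)"

text \<open>
  The empty family is allowed; its intersection \<open>\<Inter>{}\<close> is \<open>UNIV\<close>, the whole algebra.
\<close>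

definition dually_atomistic :: bool where
  "dually_atomistic \<longleftrightarrow>
     (\<forall>S. subalgebra S \<longrightarrow> (\<exists>\<M>. (\<forall>M\<in>\<M>. maximal_subalgebra M) \<and> S = \<Inter>\<M>))"

definition perfect :: bool where
  "perfect \<longleftrightarrow> span {bracket x y | x y. True} = UNIV"

text \<open>
  The \<^typ>\<open>'b poly\<close>s are the elements of \<open>L[t] = L \<otimes> F[t]\<close>, and \<open>ad_poly x y\<close> is
  the map \<open>ad (t x + y)\<close> on it; \<^const>\<open>pCons\<close> \<open>0\<close> is multiplication by \<open>t\<close>.
  Jacobson's \<open>s\<^sub>i(x, y)\<close>, for \<open>0 < i < p\<close>, is determined by
  \<open>ad (t x + y)\<^sup>p\<^sup>-\<^sup>1 (x) = (\<Sum>i=1..p-1. i s\<^sub>i(x, y) t\<^sup>i\<^sup>-\<^sup>1)\<close>.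
\<close>

definition ad_poly :: "'b \<Rightarrow> 'b \<Rightarrow> 'b poly \<Rightarrow> 'b poly" where
  "ad_poly x y f = pCons 0 (map_poly (bracket x) f) + map_poly (bracket y) f"

definition jacobson_s :: "nat \<Rightarrow> 'b \<Rightarrow> 'b \<Rightarrow> 'b" where
  "jacobson_s i x y =
     inverse (of_nat i) *s coeff ((ad_poly x y ^^ (CHAR('a) - 1)) [:x:]) (i - 1)"

end

locale restricted_lie_algebra = lie_algebra scale bracket
  for scale :: "'a::field \<Rightarrow> 'b::ab_group_add \<Rightarrow> 'b" (infixr \<open>*s\<close> 75)
    and bracket :: "'b \<Rightarrow> 'b \<Rightarrow> 'b" +
  fixes pmap :: "'b \<Rightarrow> 'b"
  assumes CHAR_positive: "CHAR('a) > 0"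
    and bracket_pmap: "bracket (pmap x) = bracket x ^^ CHAR('a)"
    and pmap_scale: "pmap (c *s x) = c ^ CHAR('a) *s pmap x"
    and pmap_add: "pmap (x + y) = pmap x + pmap y + (\<Sum>i = 1..<CHAR('a). jacobson_s i x y)"

definition (in lie_algebra) restricted_dually_atomistic :: bool where
  "restricted_dually_atomistic \<longleftrightarrow>
     (\<exists>pmap. restricted_lie_algebra scale bracket pmap) \<and> dually_atomistic"

end

theory Submission
  imports Defs
begin

text \<open>
  In a perfect Lie algebra maximal subalgebras are self-normalizing, hence closed under the
  \<open>p\<close>-map. If the algebra is also dually atomistic, all subalgebras are therefore closed under
  the \<open>p\<close>-map, so that \<open>x\<^sup>[\<^sup>p\<^sup>] \<in> F x\<close> for every \<open>x\<close>. Let \<open>S\<close> be a maximal subalgebra among those on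
  which the \<open>p\<close>-map vanishes, and \<open>B\<close> its normalizer. Then \<open>B/S\<close> has no nonzero nilpotent
  elements, so it is abelian; the \<open>p\<close>-map is \<open>p\<close>-semilinear on it and preserves every line, so
  \<open>dim B/S \<le> 1\<close>. By Engel's theorem every subalgebra properly containing \<open>S\<close> meets
  \<open>B - S\<close> and hence contains \<open>B\<close>, while \<open>S\<close> is properly contained in \<open>B\<close> and is not itself
  maximal. So \<open>S\<close> is not an intersection of maximal subalgebras.
\<close>

section \<open>Normalizers, maximal subalgebras and Jacobson's terms\<close>

context lie_algebra
begin

lemma bracket_add_right: "bracket x (y + z) = bracket x y + bracket x z"
  and bracket_scale_right: "bracket x (c *s y) = c *s bracket x y"
  and bracket_add_left: "bracket (x + y) z = bracket x z + bracket y z"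
  and bracket_scale_left: "bracket (c *s x) y = c *s bracket x y"
  using linear_bracket_right linear_bracket_left
  unfolding linear_iff_module_hom module_hom_iff by blast+

lemma bracket_zero_right [simp]: "bracket x 0 = 0"
  and bracket_zero_left [simp]: "bracket 0 x = 0"
  using bracket_scale_right[of x 0 0] bracket_scale_left[of 0 0 x] by simp_all

lemma bracket_anti: "bracket y x = - bracket x y"
  using bracket_self[of "x + y"] bracket_self[of x] bracket_self[of y]
  by (simp add: bracket_add_left bracket_add_right add_eq_0_iff)

lemma bracket_minus_right: "bracket x (- y) = - bracket x y"
  using bracket_scale_right[of x "- 1" y] by simp

lemma bracket_diff_right: "bracket x (y - z) = bracket x y - bracket x z"
  using bracket_add_right[of x y "- z"] by (simp add: bracket_minus_right)

lemma bracket_leibniz: "bracket x (bracket y z) = bracket (bracket x y) z + bracket y (bracket x z)"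
proof -
  have "bracket y (bracket z x) = - bracket y (bracket x z)"
    by (metis bracket_anti bracket_minus_right)
  moreover have "bracket z (bracket x y) = - bracket (bracket x y) z"
    by (rule bracket_anti)
  ultimately show ?thesis
    using jacobi[of x y z] by (simp add: algebra_simps)
qed

lemma subspace_bracket_mem_swap:
  assumes "subspace S" "bracket x y \<in> S"
  shows "bracket y x \<in> S"
  using subspace_neg[OF assms] bracket_anti[of y x] by simp

lemma subalgebra_subspace: "subalgebra S \<Longrightarrow> subspace S"
  by (simp add: subalgebra_def)

definition normalizer :: "'b set \<Rightarrow> 'b set" where
  "normalizer S = {v. \<forall>x\<in>S. bracket v x \<in> S}"

lemma normalizerD: "v \<in> normalizer S \<Longrightarrow> x \<in> S \<Longrightarrow> bracket v x \<in> S"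
  by (simp add: normalizer_def)

lemma subalgebra_subset_normalizer: "subalgebra S \<Longrightarrow> S \<subseteq> normalizer S"
  by (auto simp: normalizer_def subalgebra_def)

lemma subalgebra_normalizer:
  assumes "subspace S"
  shows "subalgebra (normalizer S)"
proof -
  have "bracket (bracket x y) z \<in> S"
    if "x \<in> normalizer S" "y \<in> normalizer S" "z \<in> S" for x y z
  proof -
    have "bracket (bracket x y) z = bracket x (bracket y z) - bracket y (bracket x z)"
      using bracket_leibniz[of x y z] by simp
    then show ?thesis
      using that assms by (simp add: normalizerD subspace_diff)
  qed
  then have "\<forall>x\<in>normalizer S. \<forall>y\<in>normalizer S. bracket x y \<in> normalizer S"
    by (simp add: normalizer_def)
  moreover have "subspace (normalizer S)"
    using assms by (auto simp: normalizer_def subspace_def bracket_add_left bracket_scale_left)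
  ultimately show ?thesis
    by (simp add: subalgebra_def)
qed

lemma funpow_bracket_mem:
  assumes "\<And>z. z \<in> S \<Longrightarrow> bracket x z \<in> S" "z \<in> S"
  shows "(bracket x ^^ n) z \<in> S"
  using assms by (induction n) auto

text \<open>The quotient of \<open>span (insert v S)\<close> by its ideal \<open>S\<close> has
  dimension at most one, so it is abelian. Landing in \<open>S\<close> itself, not just in the span,
  is what later pushes the derived algebra into a maximal subalgebra.\<close>

lemma bracket_mem_span_insert:
  assumes S: "subalgebra S" and v: "v \<in> normalizer S"
    and x: "x \<in> span (insert v S)" and y: "y \<in> span (insert v S)"
  shows "bracket x y \<in> S"
proof -
  have ss: "subspace S" using S by (rule subalgebra_subspace)
  then have sp: "span S = S" by (rule span_eq_iff[THEN iffD2])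
  obtain a s where s: "s \<in> S" "x = s + a *s v"
    using x span_breakdown_eq[of x v S] sp by (metis diff_add_cancel)
  obtain b t where t: "t \<in> S" "y = t + b *s v"
    using y span_breakdown_eq[of y v S] sp by (metis diff_add_cancel)
  have vs: "bracket v s \<in> S" "bracket v t \<in> S"
    using v s t by (auto intro: normalizerD)
  then have "bracket s v \<in> S"
    using ss subspace_bracket_mem_swap by blast
  moreover have "bracket s t \<in> S"
    using S s t by (simp add: subalgebra_def)
  ultimately show ?thesis
    using vs ss unfolding s t
    by (simp add: bracket_add_left bracket_add_right bracket_scale_left bracket_scale_right
        bracket_self subspace_add subspace_scale)
qed

lemma subalgebra_span_insert:
  assumes "subalgebra S" "v \<in> normalizer S"
  shows "subalgebra (span (insert v S))"
  unfolding subalgebra_def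
  using bracket_mem_span_insert[OF assms] span_superset[of "insert v S"] by auto

lemma subalgebra_zero: "subalgebra {0}"
  by (simp add: subalgebra_def subspace_def)

lemma subalgebra_line: "subalgebra (span {x})"
  using subalgebra_span_insert[OF subalgebra_zero, of x] span_insert_0[of "{x}"]
  by (simp add: normalizer_def insert_commute)

text \<open>Otherwise \<open>M\<close> is an ideal by maximality. Adjoining a single
  \<open>v\<close> outside \<open>M\<close> then yields the whole algebra, so the quotient by
  \<open>M\<close> is a line and the derived algebra lies in \<open>M\<close>, against
  perfectness.\<close>

lemma maximal_self_normalizing:
  assumes "perfect" and M: "maximal_subalgebra M"
  shows "normalizer M = M"
proof (rule ccontr)
  assume "normalizer M \<noteq> M"
  have S: "subalgebra M" and ne: "M \<noteq> UNIV"
    and max: "\<And>N. subalgebra N \<Longrightarrow> M \<subseteq> N \<Longrightarrow> N = M \<or> N = UNIV"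
    using M by (auto simp: maximal_subalgebra_def)
  have ss: "subspace M" using S by (rule subalgebra_subspace)
  have n: "normalizer M = UNIV"
    using max[OF subalgebra_normalizer[OF ss] subalgebra_subset_normalizer[OF S]]
      \<open>normalizer M \<noteq> M\<close> by simp
  obtain v where v: "v \<notin> M" using ne by blast
  have "M \<subseteq> span (insert v M)" "v \<in> span (insert v M)"
    using span_superset[of "insert v M"] by auto
  then have "span (insert v M) = UNIV"
    using max[OF subalgebra_span_insert[OF S]] n v by blast
  then have "bracket x y \<in> M" for x y
    using bracket_mem_span_insert[OF S, of v x y] n by simp
  then have "{bracket x y | x y. True} \<subseteq> M" by blast
  then have "span {bracket x y | x y. True} \<subseteq> M"
    using ss by (rule span_minimal)
  then show False using \<open>perfect\<close> ne by (auto simp: perfect_def)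
qed

lemma dually_atomistic_separates:
  assumes "dually_atomistic" "subalgebra S" "x \<notin> S"
  obtains M where "maximal_subalgebra M" "S \<subseteq> M" "x \<notin> M"
proof -
  obtain \<M> where "\<forall>M\<in>\<M>. maximal_subalgebra M" "S = \<Inter>\<M>"
    using assms(1,2) unfolding dually_atomistic_def by metis
  then show thesis
    using that assms(3) by auto
qed

lemma coeff_ad_poly:
  "coeff (ad_poly x y f) i =
     (case i of 0 \<Rightarrow> 0 | Suc j \<Rightarrow> bracket x (coeff f j)) + bracket y (coeff f i)"
  by (simp add: ad_poly_def coeff_map_poly coeff_pCons split: nat.split)

text \<open>The first application of \<open>ad (t x + y)\<close> turns \<open>x\<close> into
  \<open>[y, x]\<close>, an element of \<open>S\<close>; all later ones preserve
  \<open>S[t]\<close>, because \<open>x\<close> and \<open>y\<close> normalize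
  \<open>S\<close>.\<close>

lemma jacobson_s_mem:
  assumes S: "subspace S" and p: "CHAR('a) > 1"
    and x: "x \<in> normalizer S" and y: "y \<in> normalizer S" and yx: "bracket y x \<in> S"
  shows "jacobson_s i x y \<in> S"
proof -
  have 0: "0 \<in> S" using S by (rule subspace_0)
  obtain m where m: "CHAR('a) - 1 = Suc m" using p by (cases "CHAR('a) - 1") auto
  \<comment> \<open>At least one application is required: with none, the constant coefficient is
    \<open>x\<close>, which may lie outside \<open>S\<close>.\<close>
  have "coeff ((ad_poly x y ^^ Suc m) [:x:]) j \<in> S" for j m
  proof (induction m arbitrary: j)
    case 0
    then show ?case
      using yx \<open>0 \<in> S\<close> by (auto simp: coeff_ad_poly bracket_self coeff_pCons split: nat.split)
  next
    case (Suc m)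
    then show ?case
      using x y S 0 by (auto simp: coeff_ad_poly[of x y "(ad_poly x y ^^ Suc m) [:x:]"]
          intro!: subspace_add normalizerD simp del: funpow.simps(2)
          simp: funpow.simps(2)[of "Suc m"] split: nat.split)
  qed
  then show ?thesis
    unfolding jacobson_s_def m using S by (blast intro: subspace_scale)
qed

end

section \<open>Engel's theorem\<close>

locale finite_dimensional_lie_algebra = lie_algebra scale bracket
    + finite_dimensional_vector_space scale Basis
  for scale :: "'a::field \<Rightarrow> 'b::ab_group_add \<Rightarrow> 'b" (infixr \<open>*s\<close> 75)
    and bracket :: "'b \<Rightarrow> 'b \<Rightarrow> 'b" and Basis :: "'b set"
begin

text \<open>Engel's theorem for the module \<open>V/W\<close>, phrased without quotients. A proper
  subalgebra \<open>N\<close> of \<open>K\<close> of greatest dimension turns out to have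
  codimension one, \<open>K = N + F k\<close>. The vectors that \<open>N\<close> kills modulo
  \<open>W\<close> are stable under \<open>k\<close>, which acts nilpotently, so \<open>k\<close>
  kills one of them modulo \<open>W\<close> as well.\<close>

lemma engel:
  assumes "subalgebra K"
    and "\<And>x v. x \<in> K \<Longrightarrow> \<exists>n. (bracket x ^^ n) v = 0"
    and "subspace V" "subspace W" "W \<subset> V"
    and "\<And>x v. x \<in> K \<Longrightarrow> v \<in> V \<Longrightarrow> bracket x v \<in> V"
    and "\<And>x v. x \<in> K \<Longrightarrow> v \<in> W \<Longrightarrow> bracket x v \<in> W"
  shows "\<exists>v\<in>V - W. \<forall>x\<in>K. bracket x v \<in> W"
  using assms
proof (induction "dim K" arbitrary: K V W rule: less_induct)
  case (less K V W)
  note K = \<open>subalgebra K\<close> and nil = less.prems(2) and VK = less.prems(6) and WK = less.prems(7)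
  show ?case
  proof (cases "K = {0}")
    case True
    then show ?thesis
      using \<open>W \<subset> V\<close> subspace_0[OF \<open>subspace W\<close>] by auto
  next
    case False
    let ?P = "\<lambda>N. subalgebra N \<and> N \<subset> K"
    have "?P {0}"
      using False subalgebra_zero subspace_0[OF subalgebra_subspace[OF K]] by auto
    moreover have "\<forall>N. ?P N \<longrightarrow> dim N < Suc (dim K)"
      by (auto intro: dim_subset simp: less_Suc_eq_le)
    ultimately obtain N where N: "subalgebra N" "N \<subset> K"
      and Nmax: "\<And>N'. ?P N' \<Longrightarrow> dim N' \<le> dim N"
      using ex_has_greatest_nat[of ?P "{0}" dim "Suc (dim K)"] by auto
    have subs: "subspace N" "subspace K"
      using N K by (auto intro: subalgebra_subspace)
    have "dim N < dim K"
      using N subs by (metis psubset_eq subspace_dim_equal not_le)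
    \<comment> \<open>The induction hypothesis is applied to \<open>N\<close> acting on
      \<open>K\<close> modulo \<open>N\<close>; the resulting \<open>k\<close> normalizes
      \<open>N\<close>.\<close>
    have "\<exists>k\<in>K - N. \<forall>x\<in>N. bracket x k \<in> N"
      using N K subs
      by (intro less.hyps[OF \<open>dim N < dim K\<close>] nil) (auto simp: subalgebra_def)
    then obtain k where k: "k \<in> K" "k \<notin> N" and "\<And>x. x \<in> N \<Longrightarrow> bracket x k \<in> N"
      by blast
    then have kN: "k \<in> normalizer N"
      using subspace_bracket_mem_swap[OF subs(1)] by (auto simp: normalizer_def)
    have sub: "span (insert k N) \<subseteq> K"
      using k N subs by (intro span_minimal) auto
    have "span (insert k N) = K"
    proof (rule ccontr)
      assume "span (insert k N) \<noteq> K"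
      then have "dim (span (insert k N)) \<le> dim N"
        using sub subalgebra_span_insert[OF N(1) kN] by (intro Nmax) auto
      then have "N = span (insert k N)"
        using subs span_superset[of "insert k N"] by (intro subspace_dim_equal) auto
      then show False using k span_superset[of "insert k N"] by auto
    qed
    define U where "U = {v \<in> V. \<forall>x\<in>N. bracket x v \<in> W}"
    have "\<exists>v\<in>V - W. \<forall>x\<in>N. bracket x v \<in> W"
      using N less.prems
      by (intro less.hyps[OF \<open>dim N < dim K\<close>]) auto
    then obtain u where u: "u \<in> U" "u \<notin> W"
      by (auto simp: U_def)
    have Uk: "bracket k v \<in> U" if v: "v \<in> U" for v
    proof -
      have "bracket x (bracket k v) \<in> W" if x: "x \<in> N" for x
      proof -
        have "bracket x k \<in> N"
          using kN x subspace_bracket_mem_swap[OF subs(1)] by (auto simp: normalizer_def)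
        then have "bracket (bracket x k) v \<in> W" "bracket k (bracket x v) \<in> W"
          using v x k WK by (auto simp: U_def)
        then show ?thesis
          using bracket_leibniz[of x k v] \<open>subspace W\<close> by (simp add: subspace_add)
      qed
      then show ?thesis
        using v k VK by (auto simp: U_def)
    qed
    obtain n where "(bracket k ^^ n) u = 0"
      using nil k by blast
    then have n: "(bracket k ^^ n) u \<in> W"
      using subspace_0[OF \<open>subspace W\<close>] by simp
    \<comment> \<open>\<open>m\<close> is positive because \<open>u\<close> lies outside
      \<open>W\<close>. The iterate just before it, \<open>v\<close>, is still outside
      \<open>W\<close>, while \<open>k\<close> sends it into \<open>W\<close>.\<close>
    define m where "m = (LEAST n. (bracket k ^^ n) u \<in> W)"
    have m: "(bracket k ^^ m) u \<in> W"
      unfolding m_def using n by (rule LeastI)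
    obtain j where j: "m = Suc j"
      using m u by (cases m) auto
    define v where "v = (bracket k ^^ j) u"
    have "v \<notin> W"
      using not_less_Least[of j "\<lambda>n. (bracket k ^^ n) u \<in> W"] j by (simp add: v_def m_def)
    have "bracket k v \<in> W"
      using m j by (simp add: v_def)
    have "v \<in> U"
      unfolding v_def using Uk u by (intro funpow_bracket_mem)
    have "subspace {x. bracket x v \<in> W}"
      using \<open>subspace W\<close> by (auto simp: subspace_def bracket_add_left bracket_scale_left)
    then have "span (insert k N) \<subseteq> {x. bracket x v \<in> W}"
      using \<open>v \<in> U\<close> \<open>bracket k v \<in> W\<close> by (intro span_minimal) (auto simp: U_def)
    then show ?thesis
      using \<open>v \<notin> W\<close> \<open>v \<in> U\<close> \<open>span (insert k N) = K\<close> by (auto simp: U_def)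
  qed
qed

text \<open>Engel with \<open>V = M\<close> and \<open>W = S\<close>: a vector that \<open>S\<close>
  kills modulo \<open>S\<close> normalizes \<open>S\<close>.\<close>

lemma engel_normalizer:
  assumes S: "subalgebra S" and nil: "\<And>x v. x \<in> S \<Longrightarrow> \<exists>n. (bracket x ^^ n) v = 0"
    and M: "subalgebra M" and "S \<subset> M"
  shows "\<exists>v\<in>M - S. v \<in> normalizer S"
proof -
  have "\<exists>v\<in>M - S. \<forall>x\<in>S. bracket x v \<in> S"
    using assms by (intro engel) (auto simp: subalgebra_def)
  then show ?thesis
    using subspace_bracket_mem_swap[OF subalgebra_subspace[OF S]] by (auto simp: normalizer_def)
qed

end

section \<open>Polynomials in \<open>ad y\<close>\<close>

context lie_algebra
begin

text \<open>This is \<open>q(ad y) w\<close>, the value of a polynomial at an endomorphism.\<close>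

definition poly_ad :: "'a poly \<Rightarrow> 'b \<Rightarrow> 'b \<Rightarrow> 'b" where
  "poly_ad q y w = (\<Sum>i\<le>degree q. coeff q i *s (bracket y ^^ i) w)"

lemma poly_ad_eq_sum:
  assumes "degree q \<le> n"
  shows "poly_ad q y w = (\<Sum>i\<le>n. coeff q i *s (bracket y ^^ i) w)"
  unfolding poly_ad_def using assms
  by (intro sum.mono_neutral_left) (auto simp: coeff_eq_0)

lemma funpow_bracket_add: "(bracket y ^^ i) (u + v) = (bracket y ^^ i) u + (bracket y ^^ i) v"
  by (induction i) (simp_all add: bracket_add_right)

lemma funpow_bracket_scale: "(bracket y ^^ i) (a *s v) = a *s (bracket y ^^ i) v"
  by (induction i) (simp_all add: bracket_scale_right)

lemma funpow_bracket_diff: "(bracket y ^^ i) (u - v) = (bracket y ^^ i) u - (bracket y ^^ i) v"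
  by (induction i) (simp_all add: bracket_diff_right)

lemma funpow_bracket_zero: "(bracket y ^^ i) 0 = 0"
  by (induction i) simp_all

text \<open>Evaluation at \<open>ad y\<close> is multiplicative, here with the linear factor acting
  first. Multiplying \<open>q\<close> by \<open>t\<close> shifts its coefficients, which amounts to
  one more application of \<open>ad y\<close>.\<close>

lemma poly_ad_linear_factor:
  "poly_ad ([:- a, 1:] * q) y w = poly_ad q y (bracket y w - a *s w)"
proof -
  let ?n = "degree q" and ?D = "\<lambda>i. (bracket y ^^ i) w"
  have "degree ([:- a, 1:] * q) \<le> Suc ?n"
    using degree_mult_le[of "[:- a, 1:]" q] by simp
  then have "poly_ad ([:- a, 1:] * q) y w
      = (\<Sum>i\<le>Suc ?n. (coeff (pCons 0 q) i - a * coeff q i) *s ?D i)"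
    by (simp add: poly_ad_eq_sum[of _ "Suc ?n"] del: sum.atMost_Suc)
  also have "\<dots> = (\<Sum>i\<le>Suc ?n. coeff (pCons 0 q) i *s ?D i) - (\<Sum>i\<le>Suc ?n. (a * coeff q i) *s ?D i)"
    by (simp add: scale_left_diff_distrib sum_subtractf del: sum.atMost_Suc)
  also have "(\<Sum>i\<le>Suc ?n. coeff (pCons 0 q) i *s ?D i) = (\<Sum>i\<le>?n. coeff q i *s ?D (Suc i))"
    by (subst sum.atMost_Suc_shift) simp
  also have "(\<Sum>i\<le>Suc ?n. (a * coeff q i) *s ?D i) = (\<Sum>i\<le>?n. (a * coeff q i) *s ?D i)"
    by (simp add: coeff_eq_0)
  also have "(\<Sum>i\<le>?n. coeff q i *s ?D (Suc i)) - (\<Sum>i\<le>?n. (a * coeff q i) *s ?D i)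
      = poly_ad q y (bracket y w - a *s w)"
    unfolding poly_ad_def sum_subtractf[symmetric]
    by (intro sum.cong)
      (simp_all add: funpow_bracket_diff funpow_bracket_scale scale_right_diff_distrib
        funpow_swap1 mult.commute)
  finally show ?thesis .
qed

end

section \<open>The \<open>p\<close>-map on maximal subalgebras and on lines\<close>

context restricted_lie_algebra
begin

lemma pmap_zero [simp]: "pmap 0 = 0"
  using pmap_scale[of 0 0] CHAR_positive by (metis zero_power scale_zero_left)

lemma CHAR_gt_1: "CHAR('a) > 1"
  using CHAR_positive prime_CHAR_semidom prime_gt_1_nat by blast

text \<open>The \<open>p\<close>-map is additive modulo \<open>S\<close> on elements commuting
  modulo \<open>S\<close>, since all Jacobson terms fall into \<open>S\<close>.\<close>

lemma pmap_add_mem: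
  assumes S: "subspace S" and "x \<in> normalizer S" "y \<in> normalizer S" "bracket y x \<in> S"
  shows "pmap (x + y) - (pmap x + pmap y) \<in> S"
  using assms CHAR_gt_1 by (auto simp: pmap_add intro!: subspace_sum jacobson_s_mem)

text \<open>\<open>ad (pmap x)\<close> is the \<open>p\<close>-th power of \<open>ad x\<close> and
  so preserves \<open>M\<close>. Hence \<open>pmap x\<close> normalizes \<open>M\<close>, which is
  its own normalizer.\<close>

lemma maximal_pmap_closed:
  assumes "perfect" and M: "maximal_subalgebra M" and x: "x \<in> M"
  shows "pmap x \<in> M"
proof -
  have "subalgebra M"
    using M by (simp add: maximal_subalgebra_def)
  then have "(bracket x ^^ CHAR('a)) y \<in> M" if "y \<in> M" for y
    using x that by (intro funpow_bracket_mem) (auto simp: subalgebra_def)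
  then have "pmap x \<in> normalizer M"
    by (simp add: normalizer_def bracket_pmap)
  then show ?thesis
    using maximal_self_normalizing assms by simp
qed

text \<open>The line through \<open>x\<close> is an intersection of maximal subalgebras, and each of
  these is closed under the \<open>p\<close>-map.\<close>

lemma pmap_proportional:
  assumes "perfect" and "dually_atomistic"
  obtains a where "pmap x = a *s x"
proof -
  have "pmap x \<in> span {x}"
  proof (rule ccontr)
    assume "pmap x \<notin> span {x}"
    then obtain M where "maximal_subalgebra M" "span {x} \<subseteq> M" "pmap x \<notin> M"
      using dually_atomistic_separates[OF assms(2) subalgebra_line] by blast
    then show False
      using maximal_pmap_closed[OF assms(1)] span_superset[of "{x}"] by blast
  qed
  then show ?thesis
    using that by (auto simp: span_singleton)
qed

end

section \<open>The normalizer modulo \<open>S\<close> over an algebraically closed field\<close>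

locale alg_closed_restricted_lie_algebra = restricted_lie_algebra scale bracket pmap
    + finite_dimensional_lie_algebra scale bracket Basis
  for scale :: "'a::alg_closed_field \<Rightarrow> 'b::ab_group_add \<Rightarrow> 'b" (infixr \<open>*s\<close> 75)
    and bracket :: "'b \<Rightarrow> 'b \<Rightarrow> 'b" and pmap :: "'b \<Rightarrow> 'b" and Basis :: "'b set"
begin

text \<open>Split \<open>q\<close> into linear factors and apply them to \<open>w\<close> one at a
  time. The last vector still outside \<open>S\<close> is an eigenvector modulo \<open>S\<close>,
  and it stays in \<open>V\<close> by invariance.\<close>

lemma eigenvector_mod:
  assumes S: "subspace S" and V: "subspace V" "\<And>z. z \<in> V \<Longrightarrow> bracket y z \<in> V"
  assumes "q \<noteq> 0" "w \<in> V" "w \<notin> S" "poly_ad q y w \<in> S"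
  shows "\<exists>z\<in>V - S. \<exists>a. bracket y z - a *s z \<in> S"
  using assms(4-)
proof (induction "degree q" arbitrary: q w)
  case 0
  then obtain c where c: "q = [:c:]" "c \<noteq> 0"
    by (metis degree_eq_zeroE pCons_eq_0_iff)
  then have "inverse c *s poly_ad q y w = w"
    by (simp add: poly_ad_def)
  then show ?case
    using 0 subspace_scale[OF S] by metis
next
  case (Suc n)
  then obtain a where "poly q a = 0"
    using alg_closed_imp_poly_has_root[of q] by auto
  then obtain r where r: "q = [:- a, 1:] * r"
    by (auto simp: poly_eq_0_iff_dvd dvd_def)
  have "r \<noteq> 0" using r Suc.prems by auto
  then have "degree q = Suc (degree r)"
    unfolding r by (subst degree_mult_eq) auto
  show ?case
  proof (cases "bracket y w - a *s w \<in> S")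
    case True
    then show ?thesis using Suc.prems by blast
  next
    case False
    have "poly_ad r y (bracket y w - a *s w) \<in> S"
      using Suc.prems(4) unfolding r poly_ad_linear_factor .
    moreover have "bracket y w - a *s w \<in> V"
      using V Suc.prems(2) by (simp add: subspace_diff subspace_scale)
    moreover have "n = degree r"
      using \<open>degree q = Suc (degree r)\<close> Suc.hyps(2) by simp
    ultimately show ?thesis
      using Suc.hyps(1) \<open>r \<noteq> 0\<close> False by blast
  qed
qed

context
  fixes S
  assumes S: "subalgebra S"
    and toral: "\<And>x. x \<in> normalizer S \<Longrightarrow> x \<notin> S \<Longrightarrow> \<exists>a. a \<noteq> 0 \<and> pmap x = a *s x"
begin

text \<open>If \<open>[y, x]\<close> is outside \<open>S\<close>, then \<open>ad y\<close> has an
  eigenvector \<open>z\<close> modulo \<open>S\<close> that it does not send into \<open>S\<close>.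
  Letting \<open>ad z\<close> act on \<open>y\<close> then contradicts that \<open>pmap z\<close> is
  a nonzero multiple of \<open>z\<close>.\<close>

lemma normalizer_commutes_mod:
  assumes x: "x \<in> normalizer S" and y: "y \<in> normalizer S"
  shows "bracket y x \<in> S"
proof (rule ccontr)
  assume ne: "bracket y x \<notin> S"
  have ss: "subspace S" using S by (rule subalgebra_subspace)
  have B: "subalgebra (normalizer S)" using ss by (rule subalgebra_normalizer)
  have "y \<notin> S"
    using ne x normalizerD subspace_bracket_mem_swap[OF ss] by blast
  then obtain a where a: "a \<noteq> 0" "pmap y = a *s y"
    using toral y by blast
  obtain k where k: "CHAR('a) = Suc (Suc k)"
    using CHAR_gt_1 by (metis less_imp_Suc_add plus_1_eq_Suc One_nat_def add_Suc)
  \<comment> \<open>\<open>Suc k\<close> is \<open>p - 1\<close>. \<open>V\<close> contains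
    \<open>[y, x]\<close> because \<open>(ad y)^p x = [pmap y, x] = a [y, x]\<close>. The equation
    defining \<open>V\<close> is exact, not modulo \<open>S\<close>.\<close>
  define V where "V = {z \<in> normalizer S. (bracket y ^^ Suc k) z = a *s z}"
  have Vsub: "subspace V"
    using subalgebra_subspace[OF B]
    by (auto simp: V_def subspace_def funpow_bracket_zero funpow_bracket_add funpow_bracket_scale scale_right_distrib
        mult.commute bracket_add_right bracket_scale_right)
  have Vy: "bracket y z \<in> V" if z: "z \<in> V" for z
  proof -
    have "(bracket y ^^ Suc k) (bracket y z) = bracket y ((bracket y ^^ Suc k) z)"
      by (simp add: funpow_swap1)
    also have "\<dots> = a *s bracket y z"
      using z by (simp only: V_def mem_Collect_eq bracket_scale_right)
    finally show ?thesis
      using z y B by (simp add: V_def subalgebra_def)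
  qed
  have "(bracket y ^^ CHAR('a)) x = a *s bracket y x"
    by (simp flip: bracket_pmap add: a bracket_scale_left)
  then have w: "(bracket y ^^ Suc k) (bracket y x) = a *s bracket y x"
    by (simp add: k funpow_swap1)
  then have wV: "bracket y x \<in> V"
    using x y B by (simp add: V_def subalgebra_def)
  \<comment> \<open>The polynomial \<open>t^(p-1) - a\<close>, which annihilates \<open>V\<close>
    when evaluated at \<open>ad y\<close>.\<close>
  define q where "q = monom 1 (Suc k) - [:a:]"
  have "coeff q (Suc k) = 1"
    by (simp add: q_def)
  then have "q \<noteq> 0" by auto
  have "degree q \<le> Suc k"
    unfolding q_def by (intro degree_diff_le) (auto simp: degree_monom_le)
  then have "poly_ad q y (bracket y x) = (\<Sum>i\<le>Suc k. coeff q i *s (bracket y ^^ i) (bracket y x))"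
    by (rule poly_ad_eq_sum)
  also have "\<dots> = (\<Sum>i\<le>Suc k. (if i = Suc k then (bracket y ^^ Suc k) (bracket y x) else 0)
      - (if i = 0 then a *s bracket y x else 0))"
    by (intro sum.cong) (auto simp: q_def coeff_pCons split: nat.split)
  also have "\<dots> = 0"
    unfolding sum_subtractf w by (simp add: sum.delta del: sum.atMost_Suc)
  finally have "poly_ad q y (bracket y x) \<in> S"
    using ss by (simp add: subspace_0)
  then obtain z b where z: "z \<in> V" "z \<notin> S" and b: "bracket y z - b *s z \<in> S"
    using eigenvector_mod[OF ss Vsub Vy \<open>q \<noteq> 0\<close> wV ne] by blast
  have zB: "z \<in> normalizer S" using z by (simp add: V_def)
  \<comment> \<open>\<open>(ad z)\<^sup>2 y \<in> S\<close> because \<open>[z, y] \<in> F z + S\<close>, but \<open>(ad z)\<^sup>p y\<close> is a nonzero multiple of \<open>[z, y]\<close>.\<close>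
  have scaled: "z \<in> S" if "c \<noteq> 0" "c *s z \<in> S" for c
    using subspace_scale[OF ss that(2), of "inverse c"] that(1) by simp
  \<comment> \<open>Otherwise \<open>a z = (ad y)^(p-1) z\<close> would lie in \<open>S\<close>,
    which \<open>ad y\<close> preserves.\<close>
  have yz: "bracket y z \<notin> S"
  proof
    assume "bracket y z \<in> S"
    then have "(bracket y ^^ k) (bracket y z) \<in> S"
      using y by (intro funpow_bracket_mem[of S y]) (auto intro: normalizerD)
    then have "a *s z \<in> S"
      using z by (simp add: V_def funpow_swap1)
    then show False using scaled a z by blast
  qed
  obtain c where c: "c \<noteq> 0" "pmap z = c *s z"
    using toral zB z by blast
  have "bracket z (bracket y z - b *s z) \<in> S"
    using zB b by (rule normalizerD)
  then have "bracket z (bracket y z) \<in> S"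
    by (simp add: bracket_diff_right bracket_scale_right bracket_self)
  then have "bracket z (bracket z y) \<in> S"
    using bracket_anti[of z y] bracket_minus_right subspace_neg[OF ss] by simp
  then have "(bracket z ^^ k) (bracket z (bracket z y)) \<in> S"
    using zB by (intro funpow_bracket_mem[of S z]) (auto intro: normalizerD)
  then have "(bracket z ^^ CHAR('a)) y \<in> S"
    by (simp add: k funpow_swap1)
  then have "c *s bracket z y \<in> S"
    by (simp flip: bracket_pmap add: c bracket_scale_left)
  then have "inverse c *s c *s bracket z y \<in> S"
    using ss subspace_scale by blast
  then show False
    using yz c subspace_bracket_mem_swap[OF ss] by simp
qed

text \<open>For \<open>x\<close> and \<open>y\<close> independent modulo \<open>S\<close>, compare
  \<open>pmap (x + c y) = d (x + c y)\<close> with \<open>a x + c^p b y\<close> modulo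
  \<open>S\<close>. This forces \<open>d = a\<close> and \<open>a c = c^p b\<close>, which fails for
  a suitable \<open>c\<close>.\<close>

lemma normalizer_dim_mod_le_1:
  assumes x: "x \<in> normalizer S" and y: "y \<in> normalizer S" "y \<notin> S"
  shows "\<exists>c. x - c *s y \<in> S"
proof (rule ccontr)
  assume "\<not> ?thesis"
  then have indep: "x - c *s y \<notin> S" for c by blast
  have ss: "subspace S" using S by (rule subalgebra_subspace)
  have B: "subspace (normalizer S)" using ss subalgebra_normalizer subalgebra_subspace by blast
  have scaled: "v \<in> S" if "c \<noteq> 0" "c *s v \<in> S" for c v
    using subspace_scale[OF ss that(2), of "inverse c"] that(1) by simp
  have "x \<notin> S" using indep[of 0] by simp
  then obtain a where a: "pmap x = a *s x" using toral x by blast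
  obtain b where b: "b \<noteq> 0" "pmap y = b *s y" using toral y by blast
  \<comment> \<open>A root of \<open>b t^p - a t + 1\<close> makes the two sides differ by one. It
    exists since \<open>b\<close> is nonzero, so the degree is positive.\<close>
  obtain c where c: "c ^ CHAR('a) * b \<noteq> a * c"
  proof -
    let ?q = "monom b CHAR('a) - monom a 1 + 1"
    have "coeff ?q CHAR('a) = b" using CHAR_gt_1 by simp
    then have "CHAR('a) \<le> degree ?q" using b by (intro le_degree) simp
    then obtain c where "poly ?q c = 0"
      using CHAR_gt_1 alg_closed_imp_poly_has_root[of ?q] by auto
    then show ?thesis
      by (intro that[of c]) (auto simp: poly_monom mult.commute)
  qed
  define u where "u = x + c *s y"
  have cy: "c *s y \<in> normalizer S" using B y by (simp add: subspace_scale)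
  have "u \<in> normalizer S" unfolding u_def using B x cy by (rule subspace_add)
  moreover have "u \<notin> S" using indep[of "- c"] by (simp add: u_def)
  ultimately obtain d where d: "pmap u = d *s u" using toral by blast
  have "pmap u - (pmap x + pmap (c *s y)) \<in> S"
    unfolding u_def by (rule pmap_add_mem[OF ss x cy normalizer_commutes_mod[OF x cy]])
  also have "pmap u - (pmap x + pmap (c *s y)) = (d - a) *s x + (d * c - c ^ CHAR('a) * b) *s y"
    unfolding d a b pmap_scale by (simp add: u_def algebra_simps)
  finally have mem: "(d - a) *s x + (d * c - c ^ CHAR('a) * b) *s y \<in> S" .
  show False
  proof (cases "d = a")
    case True
    then have "(a * c - c ^ CHAR('a) * b) *s y \<in> S" using mem by simp
    then show False using c y scaled by (metis right_minus_eq)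
  next
    case False
    let ?e = "- ((d * c - c ^ CHAR('a) * b) / (d - a))"
    have "(d - a) *s (x - ?e *s y) = (d - a) *s x + (d * c - c ^ CHAR('a) * b) *s y"
      using False by (simp add: scale_right_distrib)
    then show False using mem scaled[of "d - a"] indep[of ?e] False by simp
  qed
qed

end

section \<open>The contradiction from a largest subalgebra with zero \<open>p\<close>-map\<close>

lemma pmap_nilpotent: "pmap x = 0 \<Longrightarrow> \<exists>n. (bracket x ^^ n) v = 0"
  using bracket_pmap[of x] by (metis bracket_zero_left)

lemma not_perfect_dually_atomistic:
  assumes perfect: "perfect" and da: "dually_atomistic" and nz: "UNIV \<noteq> {0::'b}"
  shows False
proof -
  let ?P = "\<lambda>S. subalgebra S \<and> (\<forall>x\<in>S. pmap x = 0)"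
  have "?P {0}" by (simp add: subalgebra_zero)
  moreover have "\<forall>S. ?P S \<longrightarrow> dim S < Suc (dim UNIV)"
    using dim_subset[OF subset_UNIV] by (simp only: less_Suc_eq_le) blast
  ultimately obtain S where S: "subalgebra S" and nil: "\<And>x. x \<in> S \<Longrightarrow> pmap x = 0"
    and Smax: "\<And>S'. ?P S' \<Longrightarrow> dim S' \<le> dim S"
    using ex_has_greatest_nat[of ?P "{0}" dim "Suc (dim UNIV)"] by auto
  have ss: "subspace S" and spS: "span S = S"
    using S by (auto intro: subalgebra_subspace span_eq_iff[THEN iffD2])
  have SB: "S \<subseteq> normalizer S" using S by (rule subalgebra_subset_normalizer)
  have B: "subspace (normalizer S)" using ss subalgebra_normalizer subalgebra_subspace by blast

  have toral: "\<exists>a. a \<noteq> 0 \<and> pmap x = a *s x" if x: "x \<in> normalizer S" "x \<notin> S" for x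
  proof -
    have "pmap x \<noteq> 0"
    proof
      assume px: "pmap x = 0"
      \<comment> \<open>Additivity modulo \<open>S\<close> puts \<open>pmap u\<close> into
        \<open>S\<close>. As \<open>pmap u = a u\<close>, either \<open>a = 0\<close> or
        \<open>u\<close> itself lies in \<open>S\<close>. So the \<open>p\<close>-map vanishes on
        the larger subalgebra \<open>span (insert x S)\<close>, against the choice of
        \<open>S\<close>.\<close>
      have "pmap u = 0" if u_span: "u \<in> span (insert x S)" for u
      proof -
        obtain c s where s: "s \<in> S" and u: "u = s + c *s x"
          using u_span span_breakdown_eq[of u x S] spS by (metis diff_add_cancel)
        have cx: "c *s x \<in> normalizer S" using B x by (simp add: subspace_scale)
        have "pmap u - (pmap s + pmap (c *s x)) \<in> S"
          unfolding u using s SB cx by (intro pmap_add_mem ss normalizerD[OF cx]) auto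
        then have pu: "pmap u \<in> S"
          using nil[OF s] px by (simp add: pmap_scale)
        obtain a where a: "pmap u = a *s u"
          using pmap_proportional[OF perfect da] by blast
        show ?thesis
        proof (cases "a = 0")
          case True
          then show ?thesis using a by simp
        next
          case False
          then have "u \<in> S"
            using subspace_scale[OF ss pu, of "inverse a"] a by simp
          then show ?thesis by (rule nil)
        qed
      qed
      then have "dim (span (insert x S)) \<le> dim S"
        using subalgebra_span_insert[OF S x(1)] by (intro Smax) auto
      then have "S = span (insert x S)"
        using ss span_superset[of "insert x S"] by (intro subspace_dim_equal) auto
      then show False using x span_superset[of "insert x S"] by auto
    qed
    then show ?thesis
      using pmap_proportional[OF perfect da, of x] by (metis scale_zero_left)
  qed

  \<comment> \<open>\<open>N\<close> acts nilpotently on the whole algebra, so Engel yields an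
    element outside \<open>N\<close> normalizing it, whereas maximal subalgebras are
    self-normalizing.\<close>
  have notmax: "\<not> maximal_subalgebra N" if N: "subalgebra N" "N \<subseteq> S" for N
  proof
    assume M: "maximal_subalgebra N"
    then have "N \<subset> UNIV"
      by (auto simp: maximal_subalgebra_def)
    moreover have "\<exists>n. (bracket x ^^ n) v = 0" if "x \<in> N" for x v
      using that N(2) nil pmap_nilpotent by blast
    moreover have "subalgebra UNIV"
      by (simp add: subalgebra_def)
    ultimately have "\<exists>v\<in>UNIV - N. v \<in> normalizer N"
      using N(1) by (intro engel_normalizer)
    then show False
      using maximal_self_normalizing[OF perfect M] by blast
  qed
  have "S \<noteq> UNIV"
  proof
    assume "S = UNIV"
    obtain v :: 'b where "v \<notin> {0}" using nz by blast
    then obtain M where M: "maximal_subalgebra M"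
      using dually_atomistic_separates[OF da subalgebra_zero] by metis
    then have "subalgebra M" by (simp add: maximal_subalgebra_def)
    then show False
      using notmax[of M] M \<open>S = UNIV\<close> by simp
  qed
  then obtain x where x: "x \<in> normalizer S" "x \<notin> S"
    using engel_normalizer[OF S pmap_nilpotent[OF nil], of UNIV] by (auto simp: subalgebra_def)
  obtain M where M: "maximal_subalgebra M" "S \<subseteq> M" "x \<notin> M"
    using dually_atomistic_separates[OF da S x(2)] .
  have Msub: "subalgebra M" using M by (simp add: maximal_subalgebra_def)
  have "S \<noteq> M" using notmax[OF S] M by blast
  \<comment> \<open>Engel inside \<open>M\<close> gives \<open>y\<close>. Since the normalizer of
    \<open>S\<close> is at most a line modulo \<open>S\<close>, \<open>x\<close> is a multiple of
    \<open>y\<close> modulo \<open>S\<close> and falls into \<open>M\<close>.\<close>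
  then obtain y where y: "y \<in> M" "y \<notin> S" "y \<in> normalizer S"
    using engel_normalizer[OF S pmap_nilpotent[OF nil] Msub] M by auto
  obtain c where "x - c *s y \<in> S"
    using normalizer_dim_mod_le_1[OF S toral x(1) y(3,2)] by blast
  then have "x - c *s y + c *s y \<in> M"
    using M(2) y subalgebra_subspace[OF Msub] by (intro subspace_add subspace_scale) auto
  then show False using M by simp
qed

end

theorem theorem3p5:
  fixes scale :: "'k::alg_closed_field \<Rightarrow> 'l::ab_group_add \<Rightarrow> 'l"
    and Basis :: "'l set"
    and bracket :: "'l \<Rightarrow> 'l \<Rightarrow> 'l"
  assumes "CHAR('k) > 0"
    and "finite_dimensional_vector_space scale Basis"
    and "lie_algebra scale bracket"
    and "(UNIV :: 'l set) \<noteq> {0}"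
  shows "\<not> (lie_algebra.perfect scale bracket \<and>
            lie_algebra.restricted_dually_atomistic scale bracket)"
proof
  interpret lie_algebra scale bracket by fact
  interpret finite_dimensional_lie_algebra scale bracket Basis
    by (intro finite_dimensional_lie_algebra.intro) fact+
  assume asm: "perfect \<and> restricted_dually_atomistic"
  then obtain pmap where "restricted_lie_algebra scale bracket pmap"
    by (auto simp: restricted_dually_atomistic_def)
  then interpret alg_closed_restricted_lie_algebra scale bracket pmap Basis
    by (intro alg_closed_restricted_lie_algebra.intro finite_dimensional_lie_algebra_axioms)
  show False
    using not_perfect_dually_atomistic assms(4) asm
    by (simp add: restricted_dually_atomistic_def)
qed

end
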